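(* Let $X$ be an infinite, vertex-transitive ULF simplicial complex with $H^{\mathrm{suf}}_1(X,\mathbb{Z})=0$. Then $X$ has $H^{\mathrm{suf}}_1$-expansion.
   Context: A simplicial complex is ULF if there is a uniform bound on the cardinalities of the links of its vertices; vertex-transitive means its automorphism group acts transitively on vertices. $C^{\mathrm{suf}}_n(X,\mathbb{Z})$ is the group of uniformly bounded integer-valued functions on oriented $n$-simplices, with simplicial boundary $\partial$, sup norm $\|\cdot\|$, cycles $Z^{\mathrm{suf}}_n$, boundaries $B^{\mathrm{suf}}_n$ and homology $H^{\mathrm{suf}}_n$. For $U\subseteq VX$, $U$ also denotes the induced subcomplex, $C^{\mathrm{suf}}_n(U,\mathbb{Z})$ its chains, and $\partial U$ the set of simplices of $X$ adjacent to a vertex not in $U$. $X$ has $H^{\mathrm{suf}}_n$-expansion if there is $K:\mathbb{N}\to\mathbb{N}$ such that for every finite $U\subseteq VX$ and every $f\in C^{\mathrm{suf}}_n(U,\mathbb{Z})$ such that (1) $\partial f$ has support in $\partial U$ and (2) there is $\hat f\in Z^{\mathrm{suf}}_n(X,\mathbb{Z})$ with $\hat f|_U=f$ and $\|\hat f\|=\|f\|$, there exists $g\in C^{\mathrm{suf}}_{n+1}(X,\mathbb{Z})$ with $(\partial g)|_U=f$ and $\|g\|\le K(\|f\|)$. *)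

theory Defs
  imports "HOL-Combinatorics.Permutations" "HOL-Algebra.Elementary_Groups"
begin

definition simplicial_complex :: "'a set set \<Rightarrow> bool" where
  "simplicial_complex X \<longleftrightarrow>
     (\<forall>\<sigma>\<in>X. finite \<sigma> \<and> \<sigma> \<noteq> {} \<and> (\<forall>\<tau>. \<tau> \<subseteq> \<sigma> \<longrightarrow> \<tau> \<noteq> {} \<longrightarrow> \<tau> \<in> X))"

definition verts :: "'a set set \<Rightarrow> 'a set" where
  "verts X = \<Union>X"

definition link :: "'a set set \<Rightarrow> 'a \<Rightarrow> 'a set set" where
  "link X v = {\<sigma> \<in> X. v \<notin> \<sigma> \<and> insert v \<sigma> \<in> X}"

definition ULF :: "'a set set \<Rightarrow> bool" where
  "ULF X \<longleftrightarrow> (\<exists>N. \<forall>v\<in>verts X. finite (link X v) \<and> card (link X v) \<le> N)"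

text \<open>Automorphisms are maps of the ambient type; only their restriction to the vertices matters.\<close>

definition automorphisms :: "'a set set \<Rightarrow> ('a \<Rightarrow> 'a) set" where
  "automorphisms X =
     {\<phi>. bij_betw \<phi> (verts X) (verts X) \<and> (\<forall>\<sigma>. \<sigma> \<subseteq> verts X \<longrightarrow> (\<phi> ` \<sigma> \<in> X \<longleftrightarrow> \<sigma> \<in> X))}"

definition vertex_transitive :: "'a set set \<Rightarrow> bool" where
  "vertex_transitive X \<longleftrightarrow> (\<forall>v\<in>verts X. \<forall>w\<in>verts X. \<exists>\<phi>\<in>automorphisms X. \<phi> v = w)"

definition induced :: "'a set set \<Rightarrow> 'a set \<Rightarrow> 'a set set" where
  "induced X U = {\<sigma> \<in> X. \<sigma> \<subseteq> U}"

definition ordered_simplices :: "'a set set \<Rightarrow> nat \<Rightarrow> 'a list set" where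
  "ordered_simplices X n = {xs. length xs = Suc n \<and> distinct xs \<and> set xs \<in> X}"

text \<open>
  An oriented simplex is an ordering of the vertices of a simplex up to even permutations, and
  a chain changes sign when the orientation is reversed. A function on oriented
  simplices is thus an alternating function on ordered simplices; it is extended by 0
  to all other lists.
\<close>

definition suf_chains :: "'a set set \<Rightarrow> nat \<Rightarrow> ('a list \<Rightarrow> int) set" where
  "suf_chains X n =
     {c. (\<forall>xs. xs \<notin> ordered_simplices X n \<longrightarrow> c xs = 0) \<and>
         (\<forall>xs\<in>ordered_simplices X n. \<forall>p. p permutes {..<length xs} \<longrightarrow>
            c (permute_list p xs) = sign p * c xs) \<and>
         (\<exists>B. \<forall>xs. \<bar>c xs\<bar> \<le> B)}"

text \<open>
  The coefficient at an oriented simplex \<open>\<tau>\<close> of the linear extension of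
  \<open>\<partial>[v\<^sub>0,\<dots>,v\<^sub>n] = \<Sum>\<^sub>i (-1)\<^sup>i [v\<^sub>0,\<dots>,v\<^sub>i\<^sub>-\<^sub>1,v\<^sub>i\<^sub>+\<^sub>1,\<dots>,v\<^sub>n]\<close>: a simplex with vertices \<open>v, \<tau>\<close> that
  has \<open>\<tau>\<close> as a face contributes \<open>c [v,\<tau>]\<close>, as \<open>[v,\<tau>]\<close> is its orientation inducing \<open>\<tau>\<close>.
  The index set is finite in a ULF complex. The boundary of a 0-chain is 0 (no
  augmentation).
\<close>

definition boundary :: "'a set set \<Rightarrow> ('a list \<Rightarrow> int) \<Rightarrow> 'a list \<Rightarrow> int" where
  "boundary X c \<tau> =
     (if \<tau> = [] then 0 else \<Sum>v | v \<notin> set \<tau> \<and> insert v (set \<tau>) \<in> X. c (v # \<tau>))"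

definition suf_cycles :: "'a set set \<Rightarrow> nat \<Rightarrow> ('a list \<Rightarrow> int) set" where
  "suf_cycles X n = {c \<in> suf_chains X n. boundary X c = (\<lambda>_. 0)}"

definition suf_boundaries :: "'a set set \<Rightarrow> nat \<Rightarrow> ('a list \<Rightarrow> int) set" where
  "suf_boundaries X n = boundary X ` suf_chains X (Suc n)"

definition suf_cycle_group :: "'a set set \<Rightarrow> nat \<Rightarrow> ('a list \<Rightarrow> int) monoid" where
  "suf_cycle_group X n =
     \<lparr>carrier = suf_cycles X n, mult = (\<lambda>c d xs. c xs + d xs), one = (\<lambda>_. 0)\<rparr>"

definition suf_homology :: "'a set set \<Rightarrow> nat \<Rightarrow> ('a list \<Rightarrow> int) set monoid" where
  "suf_homology X n = suf_cycle_group X n Mod suf_boundaries X n"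

text \<open>
  Chains are bounded, so the supremum is a maximum; it is a natural number because
  the coefficients are integers.
\<close>

definition chain_norm :: "('a list \<Rightarrow> int) \<Rightarrow> nat" where
  "chain_norm c = (SUP xs. nat \<bar>c xs\<bar>)"

definition restrict_chain :: "('a list \<Rightarrow> int) \<Rightarrow> 'a set \<Rightarrow> 'a list \<Rightarrow> int" where
  "restrict_chain c U = (\<lambda>xs. if set xs \<subseteq> U then c xs else 0)"

text \<open>A simplex and a vertex are adjacent if they lie in a common simplex.\<close>

definition vertex_boundary :: "'a set set \<Rightarrow> 'a set \<Rightarrow> 'a set set" where
  "vertex_boundary X U = {\<sigma> \<in> X. \<exists>v \<in> verts X - U. insert v \<sigma> \<in> X}"

definition suf_expansion :: "'a set set \<Rightarrow> nat \<Rightarrow> bool" where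
  "suf_expansion X n \<longleftrightarrow>
     (\<exists>K :: nat \<Rightarrow> nat. \<forall>U f.
        finite U \<longrightarrow> U \<subseteq> verts X \<longrightarrow> f \<in> suf_chains (induced X U) n \<longrightarrow>
        (\<forall>xs. boundary X f xs \<noteq> 0 \<longrightarrow> set xs \<in> vertex_boundary X U) \<longrightarrow>
        (\<exists>f'\<in>suf_cycles X n. restrict_chain f' U = f \<and> chain_norm f' = chain_norm f) \<longrightarrow>
        (\<exists>g\<in>suf_chains X (Suc n).
           restrict_chain (boundary X g) U = f \<and> chain_norm g \<le> K (chain_norm f)))"

end

theory Submission imports Defs begin

text \<open>
  Let \<open>f = \<partial>g\<close> be a 1-cycle with \<open>\<parallel>f\<parallel> \<le> N\<close> and \<open>U\<close> a finite set of edges. The part of a finite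
  cut that is triangle-connected to \<open>U\<close> is a finitely supported cocycle, so \<open>f\<close> pairs to zero with
  it. Either this part stays within distance \<open>card U\<close> of \<open>U\<close>, or it has at least \<open>card U\<close>
  edges there outside \<open>U\<close>. In both cases Hoffman's cut condition holds, and \<open>f\<close> restricted to \<open>U\<close>
  extends to a finitely supported integral cycle of norm at most \<open>N\<close>.

  If cycles of norm at most \<open>N\<close> were not uniformly fillable on finite sets, one could subtract
  from badly fillable finitely supported cycles one of finitely many representatives of their
  patterns on a given finite set, and so obtain cycles of norm at most \<open>2N\<close> with disjoint finite
  supports and filling norms growing as fast as desired. Their sum would be a cycle without
  bounded filling, against the vanishing of \<open>H\<^sub>1\<close>.
\<close>

section \<open>Integral circulations\<close>

text \<open>When the next vertex already occurs on the path, the path is cut off at that occurrence.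
  Distinctness ensures that a unit of flow pushed along the path uses each arc at most once.\<close>

lemma rtrancl_imp_distinct_path:
  assumes "(x, y) \<in> R\<^sup>*"
  shows "\<exists>ps. ps \<noteq> [] \<and> hd ps = x \<and> last ps = y \<and> distinct ps \<and> successively (\<lambda>a b. (a, b) \<in> R) ps"
  using assms
proof (induction rule: rtrancl_induct)
  case base
  show ?case by (rule exI[of _ "[x]"]) simp
next
  case (step y z)
  then obtain ps where ps: "ps \<noteq> []" "hd ps = x" "last ps = y" "distinct ps"
    "successively (\<lambda>a b. (a, b) \<in> R) ps" by blast
  show ?case
  proof (cases "z \<in> set ps")
    case True
    then obtain as bs where "ps = as @ z # bs" by (meson split_list)
    then have eq: "ps = (as @ [z]) @ bs" by simp
    have "hd (as @ [z]) = x" using ps(2) unfolding eq by (cases as) auto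
    moreover have "distinct (as @ [z])" using ps(4) unfolding eq by simp
    moreover have "successively (\<lambda>a b. (a, b) \<in> R) (as @ [z])"
      using ps(5) unfolding eq successively_append_iff by blast
    ultimately show ?thesis by (intro exI[of _ "as @ [z]"]) simp
  next
    case False
    then have "distinct (ps @ [z])" using ps(4) by simp
    moreover have "successively (\<lambda>a b. (a, b) \<in> R) (ps @ [z])"
      using ps(1,3,5) step.hyps(2) by (simp add: successively_append_iff)
    ultimately show ?thesis using ps(1,2) by (intro exI[of _ "ps @ [z]"]) simp
  qed
qed

text \<open>Here \<open>g x y\<close> is the net flow from \<open>x\<close> to \<open>y\<close>, and
  the sum over \<open>u\<close> is the net inflow of a vertex. One unit is pushed along the tail of
  the path first, then along its first arc. That values change only between vertices of the path is
  what the induction needs.\<close>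

lemma push_along_path:
  fixes g :: "'a \<Rightarrow> 'a \<Rightarrow> int"
  assumes "finite V" and g: "\<And>x y. g y x = - g x y" "\<And>x y. \<bar>g x y\<bar> \<le> N"
    and R: "\<And>x y. (x, y) \<in> R \<Longrightarrow> g x y < N"
    and "successively (\<lambda>x y. (x, y) \<in> R) ps" "distinct ps" "ps \<noteq> []" "set ps \<subseteq> V"
  shows "\<exists>g'. (\<forall>x y. g' y x = - g' x y) \<and> (\<forall>x y. \<bar>g' x y\<bar> \<le> N) \<and>
    (\<forall>x y. \<not> (x \<in> set ps \<and> y \<in> set ps) \<longrightarrow> g' x y = g x y) \<and>
    (\<forall>x y. (x, y) \<notin> R \<longrightarrow> (y, x) \<notin> R \<longrightarrow> g' x y = g x y) \<and>
    (\<forall>v. (\<Sum>u\<in>V. g' u v) = (\<Sum>u\<in>V. g u v) - of_bool (v = hd ps) + of_bool (v = last ps))"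
  using assms(5-8)
proof (induction ps rule: induct_list012)
  case 1
  then show ?case by simp
next
  case (2 x)
  then show ?case by (intro exI[of _ g] conjI allI impI g refl) simp_all
next
  case (3 x y zs)
  then have xy: "(x, y) \<in> R" "x \<noteq> y" "x \<in> V" "y \<in> V" "x \<notin> set (y # zs)" by auto
  have path: "successively (\<lambda>x y. (x, y) \<in> R) (y # zs)" "distinct (y # zs)" "y # zs \<noteq> []"
    "set (y # zs) \<subseteq> V" using "3.prems" by auto
  obtain g' where g': "\<And>x y. g' y x = - g' x y" "\<And>x y. \<bar>g' x y\<bar> \<le> N"
    "\<And>a b. \<not> (a \<in> set (y # zs) \<and> b \<in> set (y # zs)) \<Longrightarrow> g' a b = g a b"
    "\<And>x y. (x, y) \<notin> R \<Longrightarrow> (y, x) \<notin> R \<Longrightarrow> g' x y = g x y"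
    "\<And>v. (\<Sum>u\<in>V. g' u v) = (\<Sum>u\<in>V. g u v) - of_bool (v = y) + of_bool (v = last (y # zs))"
    using "3.IH"(2)[OF path, unfolded list.sel] by blast
  \<comment> \<open>\<open>x\<close> is not on the rest of the path, so the first arc still has its
    original spare capacity.\<close>
  have "g' x y = g x y" using g'(3) xy by blast
  then have lt: "g' x y < N" using R xy by simp
  let ?h = "\<lambda>a b. g' a b + of_bool (a = x \<and> b = y) - of_bool (b = x \<and> a = y)"
  have "?h b a = - ?h a b" for a b using g'(1)[of a b] by linarith
  moreover have "\<bar>?h a b\<bar> \<le> N" for a b
    using g'(2)[of a b] g'(1)[of x y] lt xy(2)
    by (cases "a = x \<and> b = y"; cases "a = y \<and> b = x") auto
  moreover have "?h a b = g a b" if "\<not> (a \<in> set (x # y # zs) \<and> b \<in> set (x # y # zs))" for a b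
  proof -
    have "\<not> (a = x \<and> b = y)" "\<not> (b = x \<and> a = y)" "g' a b = g a b"
      using that g'(3)[of a b] by auto
    then show ?thesis by (simp only: of_bool_eq add_0_right diff_0_right)
  qed
  moreover have "?h a b = g a b" if "(a, b) \<notin> R" "(b, a) \<notin> R" for a b
  proof -
    have "\<not> (a = x \<and> b = y)" "\<not> (b = x \<and> a = y)" "g' a b = g a b"
      using that xy(1) g'(4)[of a b] by blast+
    then show ?thesis by (simp only: of_bool_eq add_0_right diff_0_right)
  qed
  moreover have "(\<Sum>u\<in>V. ?h u v) = (\<Sum>u\<in>V. g u v) - of_bool (v = hd (x # y # zs)) + of_bool (v = last (x # y # zs))" for v
  proof -
    have "(\<Sum>u\<in>V. of_bool (u = x \<and> v = y)) = (of_bool (v = y) :: int)"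
         "(\<Sum>u\<in>V. of_bool (v = x \<and> u = y)) = (of_bool (v = x) :: int)"
      using \<open>finite V\<close> xy(3,4) by (auto simp: of_bool_def)
    then show ?thesis using g'(5)[of v]
      by (simp add: sum.distrib sum_subtractf del: sum_of_bool_eq)
  qed
  ultimately show ?case by (intro exI[of _ ?h]) blast
qed

text \<open>Hoffman's circulation theorem with a part of the flow prescribed. A flow of least total
  excess is conserved: an excess vertex that cannot be relieved along an augmenting path determines
  a saturated cut.\<close>

lemma exists_circulation_extending:
  fixes f :: "'a \<Rightarrow> 'a \<Rightarrow> int"
  assumes "finite E" "sym E" "sym U" "U \<subseteq> E" "0 \<le> N"
    and f: "\<And>x y. f y x = - f x y" "\<And>x y. \<bar>f x y\<bar> \<le> N"
    and cut: "\<And>S. finite S \<Longrightarrow> (\<Sum>(u, v) | (u, v) \<in> U \<and> u \<notin> S \<and> v \<in> S. f u v)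
        \<le> N * int (card {(u, v). (u, v) \<in> E - U \<and> u \<notin> S \<and> v \<in> S})"
  shows "\<exists>g. (\<forall>x y. g y x = - g x y) \<and> (\<forall>x y. \<bar>g x y\<bar> \<le> N) \<and>
    (\<forall>x y. (x, y) \<notin> E \<longrightarrow> g x y = 0) \<and> (\<forall>x y. (x, y) \<in> U \<longrightarrow> g x y = f x y) \<and>
    (\<forall>v. (\<Sum>u\<in>Field E. g u v) = 0)"
proof -
  \<comment> \<open>The competitors meet every requirement except conservation; \<open>\<mu>\<close>
    measures how far they are from it.\<close>
  define F where "F = {g. (\<forall>x y. g y x = - g x y) \<and> (\<forall>x y. \<bar>g x y\<bar> \<le> N) \<and>
    (\<forall>x y. (x, y) \<notin> E \<longrightarrow> g x y = 0) \<and> (\<forall>x y. (x, y) \<in> U \<longrightarrow> g x y = f x y)}"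
  define V where "V = Field E"
  define exc where "exc g v = (\<Sum>u\<in>V. g u v)" for g :: "'a \<Rightarrow> 'a \<Rightarrow> int" and v
  define \<mu> where "\<mu> g = nat (\<Sum>v\<in>V. \<bar>exc g v\<bar>)" for g
  have V: "finite V" "\<And>x y. (x, y) \<in> E \<Longrightarrow> x \<in> V \<and> y \<in> V"
    using assms(1) by (auto simp: V_def finite_Field intro: FieldI1 FieldI2)
  have symE: "(y, x) \<in> E \<longleftrightarrow> (x, y) \<in> E" and symU: "(y, x) \<in> U \<longleftrightarrow> (x, y) \<in> U" for x y
    using assms(2,3) by (blast dest: symD)+
  have "(\<lambda>x y. if (x, y) \<in> U then f x y else 0) \<in> F"
    unfolding F_def
  proof (intro CollectI conjI allI impI)
    fix x y
    show "(if (y, x) \<in> U then f y x else 0) = - (if (x, y) \<in> U then f x y else 0)"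
      using f(1)[of x y] symU[of x y] by simp
  qed (use f(2) assms(4,5) in auto)
  then obtain g where gF: "g \<in> F" and least: "\<And>g'. g' \<in> F \<Longrightarrow> \<mu> g \<le> \<mu> g'"
    using ex_has_least_nat[of "\<lambda>g. g \<in> F" _ \<mu>] by blast
  have g: "\<And>x y. g y x = - g x y" "\<And>x y. \<bar>g x y\<bar> \<le> N" "\<And>x y. (x, y) \<notin> E \<Longrightarrow> g x y = 0"
    "\<And>x y. (x, y) \<in> U \<Longrightarrow> g x y = f x y" using gF unfolding F_def by blast+
  \<comment> \<open>Flow between vertices of \<open>A\<close> cancels by antisymmetry, so only arcs
    from outside contribute to the excess of a set.\<close>
  have internal: "(\<Sum>v\<in>A. \<Sum>u\<in>A. g u v) = 0" for A
  proof -
    have "(\<Sum>v\<in>A. \<Sum>u\<in>A. g u v) = (\<Sum>v\<in>A. \<Sum>u\<in>A. - g v u)"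
      by (intro sum.cong refl g(1))
    also have "\<dots> = - (\<Sum>v\<in>A. \<Sum>u\<in>A. g v u)" by (simp add: sum_negf)
    also have "(\<Sum>v\<in>A. \<Sum>u\<in>A. g v u) = (\<Sum>v\<in>A. \<Sum>u\<in>A. g u v)" by (rule sum.swap)
    finally show ?thesis by simp
  qed
  have no_excess: "exc g v \<le> 0" if "v \<in> V" for v
  proof (rule ccontr)
    assume pos: "\<not> exc g v \<le> 0"
    \<comment> \<open>\<open>R\<close> holds the arcs outside \<open>U\<close> with spare capacity,
      so a push along \<open>R\<close> keeps the prescribed values; \<open>S\<close> is what
      \<open>v\<close> can reach.\<close>
    define R where "R = {(x, y). (x, y) \<in> E - U \<and> g x y < N}"
    define S where "S = {w. (v, w) \<in> R\<^sup>*}"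
    have "S \<subseteq> V"
    proof
      fix w assume "w \<in> S"
      then have "(v, w) \<in> R\<^sup>*" by (simp add: S_def)
      then show "w \<in> V" by (cases rule: rtranclE) (use that V in \<open>auto simp: R_def\<close>)
    qed
    have vS: "v \<in> S" by (simp add: S_def)
    \<comment> \<open>If a reachable vertex had a deficit, moving one unit from \<open>v\<close> to
      it would lower both absolute excesses and contradict minimality.\<close>
    have nonneg: "exc g w \<ge> 0" if "w \<in> S" for w
    proof (rule ccontr)
      assume neg: "\<not> exc g w \<ge> 0"
      obtain ps where ps: "ps \<noteq> []" "hd ps = v" "last ps = w" "distinct ps"
        "successively (\<lambda>a b. (a, b) \<in> R) ps"
        using rtrancl_imp_distinct_path \<open>w \<in> S\<close> by (metis S_def mem_Collect_eq)
      have "set ps \<subseteq> V"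
      proof
        fix a assume "a \<in> set ps"
        then obtain as bs where ab: "ps = as @ a # bs" by (meson split_list)
        show "a \<in> V"
        proof (cases "as = []")
          case True
          then show ?thesis using ab ps(2) \<open>v \<in> V\<close> by simp
        next
          case False
          then have "(last as, a) \<in> R" using ab ps(5) by (simp add: successively_append_iff)
          then show ?thesis using V by (auto simp: R_def)
        qed
      qed
      then obtain g' where g': "\<forall>x y. g' y x = - g' x y" "\<forall>x y. \<bar>g' x y\<bar> \<le> N"
        "\<forall>x y. (x, y) \<notin> R \<longrightarrow> (y, x) \<notin> R \<longrightarrow> g' x y = g x y"
        "\<forall>u. exc g' u = exc g u - of_bool (u = v) + of_bool (u = w)"
        using push_along_path[of V g N R ps, OF V(1) g(1,2) _ ps(5,4,1)] ps(2,3)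
        unfolding exc_def R_def by blast
      have "g' \<in> F"
        unfolding F_def
      proof (intro CollectI conjI g'(1,2) allI impI)
        show "g' x y = 0" if "(x, y) \<notin> E" for x y
          using that g'(3)[rule_format, of x y] g(3)[of x y] symE[of x y] by (simp add: R_def)
        show "g' x y = f x y" if "(x, y) \<in> U" for x y
          using that g'(3)[rule_format, of x y] g(4)[of x y] symU[of x y] by (simp add: R_def)
      qed
      then have "\<mu> g \<le> \<mu> g'" by (rule least)
      moreover have "\<mu> g' < \<mu> g"
      proof -
        have "v \<noteq> w" using pos neg by auto
        have "(\<Sum>u\<in>V. \<bar>exc g' u\<bar>) < (\<Sum>u\<in>V. \<bar>exc g u\<bar>)"
        proof (rule sum_strict_mono_ex1[OF V(1)])
          show "\<forall>u\<in>V. \<bar>exc g' u\<bar> \<le> \<bar>exc g u\<bar>" using g'(4) pos neg by auto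
          show "\<exists>u\<in>V. \<bar>exc g' u\<bar> < \<bar>exc g u\<bar>"
            using g'(4) pos \<open>v \<in> V\<close> \<open>v \<noteq> w\<close> by (intro bexI[of _ v]) auto
        qed
        moreover have "0 \<le> (\<Sum>u\<in>V. \<bar>exc g' u\<bar>)" by (simp add: sum_nonneg)
        ultimately show ?thesis unfolding \<mu>_def by linarith
      qed
      ultimately show False by simp
    qed
    have fS: "finite S" using \<open>S \<subseteq> V\<close> V(1) finite_subset by blast
    have "0 < exc g v" using pos by simp
    also have "exc g v \<le> (\<Sum>w\<in>S. exc g w)"
      using member_le_sum[OF vS, of "exc g"] nonneg fS by auto
    also have "\<dots> = (\<Sum>w\<in>S. \<Sum>u\<in>V - S. g u w) + (\<Sum>w\<in>S. \<Sum>u\<in>S. g u w)"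
      unfolding exc_def sum.distrib[symmetric]
      by (intro sum.cong refl sum.subset_diff \<open>S \<subseteq> V\<close> V(1))
    also have "\<dots> = (\<Sum>w\<in>S. \<Sum>u\<in>V - S. g u w)" using internal by simp
    also have "\<dots> = (\<Sum>(u, w)\<in>(V - S) \<times> S. g u w)"
      by (subst sum.swap) (simp add: sum.cartesian_product)
    also have "\<dots> = (\<Sum>(u, w) | (u, w) \<in> E \<and> u \<notin> S \<and> w \<in> S. g u w)"
      using V \<open>finite S\<close> g(3) by (intro sum.mono_neutral_right) auto
    also have "{(u, w). (u, w) \<in> E \<and> u \<notin> S \<and> w \<in> S} =
       {(u, w). (u, w) \<in> U \<and> u \<notin> S \<and> w \<in> S} \<union> {(u, w). (u, w) \<in> E - U \<and> u \<notin> S \<and> w \<in> S}"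
      using assms(4) by auto
    also have "(\<Sum>(u, w)\<in>\<dots>. g u w) = (\<Sum>(u, w) | (u, w) \<in> U \<and> u \<notin> S \<and> w \<in> S. g u w)
        + (\<Sum>(u, w) | (u, w) \<in> E - U \<and> u \<notin> S \<and> w \<in> S. g u w)"
    proof (rule sum.union_disjoint)
      show "finite {(u, w). (u, w) \<in> U \<and> u \<notin> S \<and> w \<in> S}"
        by (rule finite_subset[OF _ assms(1)]) (use assms(4) in auto)
      show "finite {(u, w). (u, w) \<in> E - U \<and> u \<notin> S \<and> w \<in> S}"
        by (rule finite_subset[OF _ assms(1)]) auto
    qed auto
    \<comment> \<open>Since \<open>u\<close> is not reachable, the reverse arc has no spare
      capacity: it carries \<open>N\<close>, so the arc into \<open>S\<close> carries
      \<open>- N\<close>.\<close>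
    also have "(\<Sum>(u, w) | (u, w) \<in> E - U \<and> u \<notin> S \<and> w \<in> S. g u w)
        = (\<Sum>(u, w) | (u, w) \<in> E - U \<and> u \<notin> S \<and> w \<in> S. - N)"
    proof (intro sum.cong refl, clarify)
      fix u w assume *: "(u, w) \<in> E" "(u, w) \<notin> U" "u \<notin> S" "w \<in> S"
      then have "(w, u) \<in> E - U" using symE symU by simp
      moreover have "(w, u) \<notin> R"
        using * unfolding S_def by (metis mem_Collect_eq rtrancl.rtrancl_into_rtrancl)
      ultimately have "g w u \<ge> N" by (auto simp: R_def)
      then show "g u w = - N" using g(1)[of w u] g(2)[of w u] by linarith
    qed
    also have "(\<Sum>(u, w) | (u, w) \<in> U \<and> u \<notin> S \<and> w \<in> S. g u w) =
        (\<Sum>(u, w) | (u, w) \<in> U \<and> u \<notin> S \<and> w \<in> S. f u w)"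
      by (intro sum.cong refl) (auto simp: g(4))
    finally have "0 < (\<Sum>(u, w) | (u, w) \<in> U \<and> u \<notin> S \<and> w \<in> S. f u w)
       - N * int (card {(u, w). (u, w) \<in> E - U \<and> u \<notin> S \<and> w \<in> S})"
      by (simp add: case_prod_unfold mult.commute)
    then show False using cut[OF fS] by linarith
  qed
  have "exc g v = 0" for v
  proof (cases "v \<in> V")
    case True
    \<comment> \<open>The total excess is zero by antisymmetry, and terms of one sign with sum zero
      all vanish.\<close>
    have "(\<Sum>v\<in>V. - exc g v) = 0" using internal[of V] by (simp add: exc_def sum_negf)
    then show ?thesis
      using True no_excess sum_nonneg_eq_0_iff[OF V(1), of "\<lambda>v. - exc g v"] by auto
  next
    case False
    then show ?thesis unfolding exc_def using V(2) g(3) by (intro sum.neutral) blast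
  qed
  then show ?thesis using g unfolding exc_def V_def by blast
qed

section \<open>Chains of low degree\<close>

lemma simplex_subset:
  assumes "simplicial_complex X" "\<sigma> \<in> X" "\<tau> \<subseteq> \<sigma>" "\<tau> \<noteq> {}"
  shows "\<tau> \<in> X"
  using assms unfolding simplicial_complex_def by blast

text \<open>The neighbours other than \<open>v\<close> embed as singletons in the link of
  \<open>v\<close>. A vertex \<open>v\<close> belongs to the set itself, because
  \<open>{v, v}\<close> collapses to \<open>{v}\<close>.\<close>

lemma finite_neighbours:
  assumes "simplicial_complex X" "ULF X"
  shows "finite {u. {u, v} \<in> X}"
proof (cases "v \<in> verts X")
  case True
  have "(\<lambda>u. {u}) ` ({u. {u, v} \<in> X} - {v}) \<subseteq> link X v"
  proof (rule image_subsetI)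
    fix u assume "u \<in> {u. {u, v} \<in> X} - {v}"
    then have u: "{u, v} \<in> X" "u \<noteq> v" by auto
    have "{u} \<in> X" by (rule simplex_subset[OF assms(1) u(1)]) auto
    then show "{u} \<in> link X v" using u by (simp add: link_def insert_commute)
  qed
  moreover have "finite (link X v)" using assms(2) True unfolding ULF_def by blast
  ultimately have "finite ((\<lambda>u. {u}) ` ({u. {u, v} \<in> X} - {v}))" by (rule finite_subset)
  then have "finite ({u. {u, v} \<in> X} - {v})" by (rule finite_imageD) simp
  then show ?thesis by simp
next
  case False
  then have "{u. {u, v} \<in> X} = {}" unfolding verts_def by blast
  then show ?thesis by simp
qed

lemma finite_cofaces:
  assumes "simplicial_complex X" "ULF X" "\<tau> \<noteq> []"
  shows "finite {v. v \<notin> set \<tau> \<and> insert v (set \<tau>) \<in> X}"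
proof (rule finite_subset)
  show "{v. v \<notin> set \<tau> \<and> insert v (set \<tau>) \<in> X} \<subseteq> {u. {u, hd \<tau>} \<in> X}"
  proof clarify
    fix v assume v: "insert v (set \<tau>) \<in> X"
    show "{v, hd \<tau>} \<in> X" by (rule simplex_subset[OF assms(1) v]) (use assms(3) in auto)
  qed
  show "finite {u. {u, hd \<tau>} \<in> X}" by (rule finite_neighbours[OF assms(1,2)])
qed

lemma suf_chain_eq_0:
  "c \<in> suf_chains X n \<Longrightarrow> xs \<notin> ordered_simplices X n \<Longrightarrow> c xs = 0"
  unfolding suf_chains_def by blast

text \<open>The sign rule extends to lists that are not ordered simplices, since permuting such a
  list gives another one and the chain vanishes on both.\<close>

lemma suf_chain_transpose:
  assumes "c \<in> suf_chains X n" "length xs = Suc n" "i < Suc n" "j < Suc n" "i \<noteq> j"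
  shows "c (permute_list (transpose i j) xs) = - c xs"
proof -
  have p: "transpose i j permutes {..<length xs}"
    using assms by (intro permutes_swap_id) auto
  show ?thesis
  proof (cases "xs \<in> ordered_simplices X n")
    case True
    then show ?thesis using assms p unfolding suf_chains_def by (auto simp: sign_swap_id)
  next
    case False
    then have "permute_list (transpose i j) xs \<notin> ordered_simplices X n"
      using p by (simp add: ordered_simplices_def)
    then show ?thesis using suf_chain_eq_0[OF assms(1)] False by simp
  qed
qed

lemma suf_chain_2_alternating:
  assumes "c \<in> suf_chains X 2"
  shows "c [x, y, z] = - c [y, x, z]" "c [x, y, z] = - c [z, y, x]"
  using suf_chain_transpose[OF assms, of "[y, x, z]" 0 1]
    suf_chain_transpose[OF assms, of "[z, y, x]" 0 2]
  by (simp_all add: permute_list_def upt_rec transpose_def)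

text \<open>The only permutations of two positions are the identity and the transposition, so
  alternation reduces to antisymmetry. This form lets flows be read as 1-chains.\<close>

lemma suf_chains_1_iff:
  "c \<in> suf_chains X 1 \<longleftrightarrow> (\<forall>xs. xs \<notin> ordered_simplices X 1 \<longrightarrow> c xs = 0) \<and>
     (\<forall>x y. c [y, x] = - c [x, y]) \<and> (\<exists>B. \<forall>xs. \<bar>c xs\<bar> \<le> B)"
proof safe
  assume c: "c \<in> suf_chains X 1"
  show "c xs = 0" if "xs \<notin> ordered_simplices X 1" for xs
    using c that by (rule suf_chain_eq_0)
  show "c [y, x] = - c [x, y]" for x y
    using suf_chain_transpose[OF c, of "[x, y]" 0 1]
    by (simp add: permute_list_def upt_rec transpose_def)
  show "\<exists>B. \<forall>xs. \<bar>c xs\<bar> \<le> B" using c unfolding suf_chains_def by blast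
next
  fix B assume c: "\<forall>xs. xs \<notin> ordered_simplices X 1 \<longrightarrow> c xs = 0"
    "\<forall>x y. c [y, x] = - c [x, y]" "\<forall>xs. \<bar>c xs\<bar> \<le> B"
  have "c (permute_list p xs) = sign p * c xs"
    if xs: "xs \<in> ordered_simplices X 1" and p: "p permutes {..<length xs}" for xs p
  proof -
    have "length xs = 2" using xs by (simp add: ordered_simplices_def)
    then obtain x y where xy: "xs = [x, y]" by (auto simp: numeral_2_eq_2 length_Suc_conv)
    have p01: "p permutes {0, 1}" using p by (simp add: xy lessThan_Suc insert_commute)
    then consider "p = id" | "p = transpose 0 1"
      using permutes_doubleton_iff[of p 0 1] by auto
    then show ?thesis
    proof cases
      case 1
      then show ?thesis by simp
    next
      case 2
      then have "permute_list p xs = [y, x]"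
        by (simp add: xy permute_list_def upt_rec transpose_def)
      moreover have "sign p = -1" using 2 by (simp add: sign_swap_id)
      ultimately show ?thesis using c(2)[rule_format, of y x] by (simp add: xy)
    qed
  qed
  then show "c \<in> suf_chains X 1" using c(1,3) unfolding suf_chains_def by blast
qed

section \<open>Linear structure, norm and vanishing homology\<close>

lemma zero_suf_chain: "(\<lambda>_. 0) \<in> suf_chains X n"
  unfolding suf_chains_def by auto

lemma suf_chains_add:
  assumes "c \<in> suf_chains X n" "d \<in> suf_chains X n"
  shows "(\<lambda>xs. c xs + d xs) \<in> suf_chains X n"
proof -
  obtain B B' where "\<forall>xs. \<bar>c xs\<bar> \<le> B" "\<forall>xs. \<bar>d xs\<bar> \<le> B'"
    using assms unfolding suf_chains_def by blast
  then have "\<forall>xs. \<bar>c xs + d xs\<bar> \<le> B + B'" by (metis abs_triangle_ineq add_mono order_trans)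
  then show ?thesis using assms unfolding suf_chains_def by (auto simp: distrib_left)
qed

lemma suf_chains_diff:
  assumes "c \<in> suf_chains X n" "d \<in> suf_chains X n"
  shows "(\<lambda>xs. c xs - d xs) \<in> suf_chains X n"
proof -
  obtain B B' where "\<forall>xs. \<bar>c xs\<bar> \<le> B" "\<forall>xs. \<bar>d xs\<bar> \<le> B'"
    using assms unfolding suf_chains_def by blast
  then have "\<forall>xs. \<bar>c xs - d xs\<bar> \<le> B + B'" by (metis abs_triangle_ineq4 add_mono order_trans)
  then show ?thesis using assms unfolding suf_chains_def by (auto simp: right_diff_distrib)
qed

lemma boundary_add:
  "boundary X (\<lambda>xs. c xs + d xs) \<tau> = boundary X c \<tau> + boundary X d \<tau>"
  unfolding boundary_def by (simp add: sum.distrib)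

lemma boundary_diff:
  "boundary X (\<lambda>xs. c xs - d xs) \<tau> = boundary X c \<tau> - boundary X d \<tau>"
  unfolding boundary_def by (simp add: sum_subtractf)

lemma boundary_sum:
  "boundary X (\<lambda>xs. \<Sum>i\<in>I. c i xs) \<tau> = (\<Sum>i\<in>I. boundary X (c i) \<tau>)"
  unfolding boundary_def using sum.swap by auto

lemma suf_chains_sum:
  assumes "finite I" "\<And>i. i \<in> I \<Longrightarrow> c i \<in> suf_chains X n"
  shows "(\<lambda>xs. \<Sum>i\<in>I. c i xs) \<in> suf_chains X n"
  using assms by (induction rule: finite_induct) (auto simp: zero_suf_chain intro: suf_chains_add)

lemma boundary_eq_0:
  assumes "simplicial_complex X" "c \<in> suf_chains X (Suc n)" "\<tau> \<notin> ordered_simplices X n"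
  shows "boundary X c \<tau> = 0"
proof (cases "\<tau> = []")
  case False
  have "c (v # \<tau>) = 0" for v
  proof (rule suf_chain_eq_0[OF assms(2)])
    show "v # \<tau> \<notin> ordered_simplices X (Suc n)"
      using assms(3) False simplex_subset[OF assms(1), of "set (v # \<tau>)" "set \<tau>"]
      by (auto simp: ordered_simplices_def)
  qed
  then show ?thesis by (simp add: boundary_def)
qed (simp add: boundary_def)

lemma abs_le_chain_norm:
  assumes "c \<in> suf_chains X n"
  shows "\<bar>c xs\<bar> \<le> int (chain_norm c)"
proof -
  obtain B where B: "\<forall>xs. \<bar>c xs\<bar> \<le> B" using assms unfolding suf_chains_def by blast
  have "bdd_above (range (\<lambda>xs. nat \<bar>c xs\<bar>))"
    using B by (intro bdd_aboveI[of _ "nat B"]) (auto intro: nat_mono)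
  then have "nat \<bar>c xs\<bar> \<le> chain_norm c" unfolding chain_norm_def by (rule cSUP_upper2) auto
  then show ?thesis by linarith
qed

lemma chain_norm_le: "(\<And>xs. \<bar>c xs\<bar> \<le> int k) \<Longrightarrow> chain_norm c \<le> k"
  unfolding chain_norm_def by (rule cSUP_least) (auto simp: nat_le_iff)

text \<open>The unit of the quotient is the set of boundaries, so the coset of \<open>z\<close>
  equals that set; \<open>z\<close> lies in its own coset because 0 is a boundary.\<close>

lemma cycle_is_boundary_if_trivial_homology:
  assumes "trivial_group (suf_homology X n)" "z \<in> suf_cycles X n"
  shows "\<exists>g\<in>suf_chains X (Suc n). boundary X g = z"
proof -
  let ?Z = "suf_cycle_group X n" and ?B = "suf_boundaries X n"
  have "carrier (suf_homology X n) = {?B}"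
    using assms(1) unfolding trivial_group_def suf_homology_def FactGroup_def by auto
  moreover have "?B #>\<^bsub>?Z\<^esub> z \<in> carrier (suf_homology X n)"
    using assms(2)
    by (auto simp: suf_homology_def FactGroup_def RCOSETS_def suf_cycle_group_def)
  ultimately have "?B #>\<^bsub>?Z\<^esub> z = ?B" by simp
  moreover have "(\<lambda>_. 0) \<in> ?B"
    unfolding suf_boundaries_def
    by (rule image_eqI[OF _ zero_suf_chain]) (auto simp: boundary_def)
  then have "z \<in> ?B #>\<^bsub>?Z\<^esub> z" 
    by (auto simp: r_coset_def suf_cycle_group_def intro!: bexI[of _ "\<lambda>_. 0"])
  ultimately show ?thesis unfolding suf_boundaries_def by auto
qed

section \<open>Truncating a cycle to finite support\<close>

text \<open>Each edge appears in both directions, so that a 1-chain becomes an antisymmetric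
  flow.\<close>

definition arcs :: "'a set set \<Rightarrow> ('a \<times> 'a) set" where
  "arcs X = {(u, v). u \<noteq> v \<and> {u, v} \<in> X}"

text \<open>This adds one layer of arcs. The set \<open>{a, b, u, v}\<close> collapses when the arcs
  share an endpoint, so the sides of a common triangle are included.\<close>

definition thicken :: "'a set set \<Rightarrow> ('a \<times> 'a) set \<Rightarrow> ('a \<times> 'a) set" where
  "thicken X B = B \<union> {(a, b) \<in> arcs X. \<exists>(u, v)\<in>B. {a, b, u, v} \<in> X}"

lemma finite_thicken:
  assumes "simplicial_complex X" "ULF X" "finite B"
  shows "finite (thicken X B)"
proof -
  have "thicken X B \<subseteq> B \<union> (\<Union>(u, v)\<in>B. {a. {a, u} \<in> X} \<times> {b. {b, u} \<in> X})"
    unfolding thicken_def by (auto intro: simplex_subset[OF assms(1)])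
  moreover have "finite (B \<union> (\<Union>(u, v)\<in>B. {a. {a, u} \<in> X} \<times> {b. {b, u} \<in> X}))"
    using assms(3) finite_neighbours[OF assms(1,2)] by auto
  ultimately show ?thesis by (rule finite_subset)
qed

lemma sym_thicken: "sym B \<Longrightarrow> sym (thicken X B)"
  unfolding thicken_def sym_def arcs_def by (auto simp: insert_commute)

lemma thicken_subset_arcs: "B \<subseteq> arcs X \<Longrightarrow> thicken X B \<subseteq> arcs X"
  unfolding thicken_def by auto

lemma thicken_increasing: "B \<subseteq> thicken X B"
  unfolding thicken_def by auto

lemma thicken_pow:
  assumes "simplicial_complex X" "ULF X" "finite U" "sym U" "U \<subseteq> arcs X"
  shows "finite ((thicken X ^^ i) U) \<and> sym ((thicken X ^^ i) U) \<and> U \<subseteq> (thicken X ^^ i) U \<and>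
    (thicken X ^^ i) U \<subseteq> arcs X"
proof (induction i)
  case (Suc i)
  then show ?case
    using finite_thicken[OF assms(1,2)] sym_thicken thicken_subset_arcs thicken_increasing
    by (metis comp_apply funpow.simps(2) subset_trans)
qed (use assms in auto)

text \<open>The arcs in \<open>C\<close> carry a finitely supported cocycle, namely a union of triangle-connected
  components of the cut defined by \<open>S\<close>; a boundary pairs to zero with it.\<close>

lemma sum_boundary_cut_component:
  assumes "simplicial_complex X" "ULF X" "g \<in> suf_chains X 2" "finite C"
    and C: "\<And>u v. (u, v) \<in> C \<Longrightarrow> u \<notin> S \<and> v \<in> S"
    and closed: "\<And>u v w. (u, v) \<in> C \<Longrightarrow> {w, u, v} \<in> X \<Longrightarrow> w \<in> S \<Longrightarrow> (u, w) \<in> C"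
      "\<And>u v w. (u, v) \<in> C \<Longrightarrow> {w, u, v} \<in> X \<Longrightarrow> w \<notin> S \<Longrightarrow> (w, v) \<in> C"
  shows "(\<Sum>(u, v)\<in>C. boundary X g [u, v]) = 0"
proof -
  let ?W = "\<lambda>(u, v). {w. w \<notin> set [u, v] \<and> insert w (set [u, v]) \<in> X}"
  let ?T = "Sigma C ?W"
  let ?G = "\<lambda>((u, v), w). g [w, u, v]"
  \<comment> \<open>A triangle with vertices on both sides of \<open>S\<close> has exactly two
    crossing edges. \<open>?\<tau>\<close> exchanges them, together with the opposite vertex; it is
    an involution that reverses the sign of \<open>?G\<close>, so the sum equals its own
    negative.\<close>
  let ?\<tau> = "\<lambda>((u, v), w). if w \<in> S then ((u, w), v) else ((w, v), u)"
  have "(\<Sum>(u, v)\<in>C. boundary X g [u, v]) = (\<Sum>p\<in>C. \<Sum>w\<in>?W p. ?G (p, w))"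
    by (intro sum.cong refl) (auto simp: boundary_def)
  also have "\<dots> = sum ?G ?T"
  proof (subst sum.Sigma)
    show "\<forall>p\<in>C. finite (?W p)"
      unfolding case_prod_unfold by (intro ballI finite_cofaces[OF assms(1,2)]) simp
  qed (use assms(4) in auto)
  finally have s: "(\<Sum>(u, v)\<in>C. boundary X g [u, v]) = sum ?G ?T" .
  have "sum ?G ?T = sum (\<lambda>t. - ?G t) ?T"
  proof (rule sum.reindex_bij_witness[of _ ?\<tau> ?\<tau>])
    fix t assume "t \<in> ?T"
    then obtain u v w where t: "t = ((u, v), w)" "(u, v) \<in> C" "w \<noteq> u" "w \<noteq> v" "{w, u, v} \<in> X"
      by auto
    have uv: "u \<notin> S" "v \<in> S" "u \<noteq> v" using C t(2) by auto
    have X: "{u, w, v} \<in> X" "{v, u, w} \<in> X" using t(5) by (simp_all add: insert_commute)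
    show "?\<tau> (?\<tau> t) = t" "?\<tau> (?\<tau> t) = t" using t uv by auto
    show "?\<tau> t \<in> ?T" "?\<tau> t \<in> ?T" using t uv X closed[OF t(2,5)] by auto
    show "- ?G (?\<tau> t) = ?G t"
      using t suf_chain_2_alternating[OF assms(3), of w u v] by auto
  qed
  then show ?thesis unfolding s by (simp add: sum_negf)
qed

text \<open>The component \<open>C\<close> of the cut that meets \<open>U\<close> has total flow
  zero, so the flow through \<open>A \<inter> U\<close> is balanced by that through
  \<open>C - U\<close>. If \<open>C\<close> stays in \<open>E\<close>, each arc of
  \<open>C - U\<close> takes at most \<open>N\<close>. Otherwise \<open>E - U\<close> contains at
  least \<open>card U\<close> arcs of the cut, and the trivial bound on \<open>A \<inter> U\<close>
  suffices.\<close>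

lemma cut_condition:
  fixes N :: int
  assumes "simplicial_complex X" "ULF X" "g \<in> suf_chains X 2"
    and f: "\<And>u v. f u v = boundary X g [u, v]" "\<And>u v. \<bar>f u v\<bar> \<le> N"
    and U: "finite U" "sym U" "U \<subseteq> arcs X" and "finite S"
  defines "E \<equiv> (thicken X ^^ card U) U"
  shows "(\<Sum>(u, v) | (u, v) \<in> U \<and> u \<notin> S \<and> v \<in> S. f u v)
     \<le> N * int (card {(u, v). (u, v) \<in> E - U \<and> u \<notin> S \<and> v \<in> S})"
proof -
  define A where "A = {(u, v). (u, v) \<in> arcs X \<and> u \<notin> S \<and> v \<in> S}"
  \<comment> \<open>Two arcs of the cut are linked when a simplex contains both; this matches one
    step of \<open>thicken\<close>.\<close>
  define Q where "Q = {((a, b), (u, v)). (a, b) \<in> A \<and> (u, v) \<in> A \<and> {a, b, u, v} \<in> X}"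
  define C where "C = Q\<^sup>* `` (A \<inter> U)"
  have "0 \<le> N" using f(2)[of undefined undefined] by linarith
  have finE: "finite ((thicken X ^^ i) U)" for i
    using thicken_pow[OF assms(1,2) U] by blast
  have "A \<subseteq> (\<Union>v\<in>S. {u. {u, v} \<in> X} \<times> {v})" unfolding A_def arcs_def by auto
  moreover have "finite (\<Union>v\<in>S. {u. {u, v} \<in> X} \<times> {v})"
    using \<open>finite S\<close> finite_neighbours[OF assms(1,2)] by auto
  ultimately have "finite A" by (rule finite_subset)
  have "C \<subseteq> A"
  proof
    fix q assume "q \<in> C"
    then obtain p where "p \<in> A" "(p, q) \<in> Q\<^sup>*" unfolding C_def by auto
    from this(2,1) show "q \<in> A" by (cases rule: rtranclE) (auto simp: Q_def)
  qed
  then have "finite C" using \<open>finite A\<close> finite_subset by blast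
  have AU: "A \<inter> U \<subseteq> C" unfolding C_def by auto
  have CQ: "q \<in> C" if "p \<in> C" "(p, q) \<in> Q" for p q
    using that unfolding C_def by (auto intro: rtrancl_into_rtrancl)
  have C: "u \<notin> S" "v \<in> S" "u \<noteq> v" "(u, v) \<in> A" if "(u, v) \<in> C" for u v
    using that \<open>C \<subseteq> A\<close> unfolding A_def arcs_def by auto
  have "(\<Sum>(u, v)\<in>C. boundary X g [u, v]) = 0"
  proof (rule sum_boundary_cut_component[OF assms(1-3) \<open>finite C\<close>])
    fix u v w assume uv: "(u, v) \<in> C" and w: "{w, u, v} \<in> X"
    have sub: "{u, w} \<in> X" "{w, v} \<in> X"
      using w by (auto intro: simplex_subset[OF assms(1) w])
    show "(u, w) \<in> C" if "w \<in> S"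
    proof (rule CQ[OF uv])
      have "{u, v, u, w} = {w, u, v}" by auto
      then show "((u, v), (u, w)) \<in> Q"
        using C[OF uv] w that sub unfolding Q_def A_def arcs_def by auto
    qed
    show "(w, v) \<in> C" if "w \<notin> S"
    proof (rule CQ[OF uv])
      have "{u, v, w, v} = {w, u, v}" by auto
      then show "((u, v), (w, v)) \<in> Q"
        using C[OF uv] w that sub unfolding Q_def A_def arcs_def by auto
    qed
  qed (use C in auto)
  then have sum0: "(\<Sum>p\<in>C. case_prod f p) = 0" by (simp add: f(1) case_prod_unfold)
  have eqU: "{(u, v). (u, v) \<in> U \<and> u \<notin> S \<and> v \<in> S} = A \<inter> U"
    using U(3) unfolding A_def by auto
  have "E \<subseteq> arcs X" unfolding E_def using thicken_pow[OF assms(1,2) U] by blast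
  then have eqE: "{(u, v). (u, v) \<in> E - U \<and> u \<notin> S \<and> v \<in> S} = A \<inter> (E - U)"
    unfolding A_def by auto
  have bound: "sum (case_prod f) B \<le> N * int (card B)" "- sum (case_prod f) B \<le> N * int (card B)" for B
  proof -
    have "\<bar>sum (case_prod f) B\<bar> \<le> (\<Sum>p\<in>B. N)"
      using f(2)
      by (intro order_trans[OF sum_abs] sum_mono) (auto split: prod.splits)
    then show "sum (case_prod f) B \<le> N * int (card B)" "- sum (case_prod f) B \<le> N * int (card B)"
      by (auto simp: mult.commute)
  qed
  have "(\<Sum>p\<in>A \<inter> U. case_prod f p) \<le> N * int (card (A \<inter> (E - U)))"
  proof (cases "C \<subseteq> E")
    case True
    have "C = (A \<inter> U) \<union> (C - U)" using AU \<open>C \<subseteq> A\<close> by auto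
    then have "sum (case_prod f) C = sum (case_prod f) (A \<inter> U) + sum (case_prod f) (C - U)"
      using \<open>finite A\<close> \<open>finite C\<close> sum.union_disjoint[of "A \<inter> U" "C - U" "case_prod f"] by auto
    then have "sum (case_prod f) (A \<inter> U) = - sum (case_prod f) (C - U)" using sum0 by linarith
    also have "\<dots> \<le> N * int (card (C - U))" by (rule bound(2))
    also have "\<dots> \<le> N * int (card (A \<inter> (E - U)))"
      using True \<open>C \<subseteq> A\<close> \<open>0 \<le> N\<close> \<open>finite A\<close>
      by (intro mult_left_mono) (auto intro!: card_mono)
    finally show ?thesis .
  next
    case False
    \<comment> \<open>A component leaving \<open>E\<close> crosses every layer of the thickening, so the cut is large there.\<close>
    have grow: "\<not> C \<subseteq> (thicken X ^^ i) U \<Longrightarrow> i \<le> card (C \<inter> ((thicken X ^^ i) U - U))" for i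
    proof (induction i)
      case (Suc i)
      let ?E = "(thicken X ^^ i) U"
      have nsub: "\<not> C \<subseteq> ?E" using Suc.prems thicken_increasing[of ?E X] by auto
      \<comment> \<open>Without a link leaving \<open>?E\<close>, every chain of links from
        \<open>A \<inter> U\<close> would stay in \<open>?E\<close>, and so would
        \<open>C\<close>.\<close>
      have "\<exists>p q. p \<in> C \<inter> ?E \<and> q \<in> C - ?E \<and> (p, q) \<in> Q"
      proof (rule ccontr)
        assume no: "\<not> ?thesis"
        have "q \<in> ?E" if p: "p \<in> A \<inter> U" and pq: "(p, q) \<in> Q\<^sup>*" for p q
          using pq
        proof (induction rule: rtrancl_induct)
          case base
          then show ?case using p thicken_pow[OF assms(1,2) U] by blast
        next
          case (step y z)
          have "y \<in> C" using step.hyps(1) p unfolding C_def by blast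
          then show ?case using no step CQ by blast
        qed
        then show False using nsub unfolding C_def by blast
      qed
      then obtain p q where pq: "p \<in> C" "p \<in> ?E" "q \<in> C" "q \<notin> ?E" "(p, q) \<in> Q" by blast
      have "q \<in> thicken X ?E"
        using pq(2,5) unfolding thicken_def Q_def A_def by (auto simp: insert_commute intro!: bexI[of _ p])
      moreover have "q \<notin> U" using pq(4) thicken_pow[OF assms(1,2) U] by blast
      ultimately have "insert q (C \<inter> (?E - U)) \<subseteq> C \<inter> ((thicken X ^^ Suc i) U - U)"
        using pq(3) thicken_increasing[of ?E X] by auto
      then have "card (insert q (C \<inter> (?E - U))) \<le> card (C \<inter> ((thicken X ^^ Suc i) U - U))"
        using \<open>finite C\<close> by (intro card_mono) auto
      moreover have "card (insert q (C \<inter> (?E - U))) = Suc (card (C \<inter> (?E - U)))"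
        using pq(4) \<open>finite C\<close> by (intro card_insert_disjoint) auto
      ultimately show ?case using Suc.IH[OF nsub] by linarith
    qed simp
    have "card (A \<inter> U) \<le> card U" using U(1) by (intro card_mono) auto
    also have "\<dots> \<le> card (C \<inter> (E - U))" using grow[of "card U"] False unfolding E_def by blast
    also have "\<dots> \<le> card (A \<inter> (E - U))"
      using \<open>C \<subseteq> A\<close> \<open>finite A\<close> by (intro card_mono) auto
    finally have "N * int (card (A \<inter> U)) \<le> N * int (card (A \<inter> (E - U)))"
      using \<open>0 \<le> N\<close> by (intro mult_left_mono) auto
    then show ?thesis using bound(1)[of "A \<inter> U"] by linarith
  qed
  then show ?thesis unfolding eqU eqE .
qed

text \<open>A filling of \<open>f\<close> yields the cut condition, so the values of
  \<open>f\<close> on \<open>W\<close> extend to a conserved flow on the finite arc set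
  \<open>E\<close>. Conservation at each vertex says that the flow is a cycle.\<close>

lemma finite_support_extension:
  fixes N :: int
  assumes "simplicial_complex X" "ULF X" "trivial_group (suf_homology X 1)"
    and f: "f \<in> suf_cycles X 1" "\<And>xs. \<bar>f xs\<bar> \<le> N" and "finite W"
  shows "\<exists>h\<in>suf_cycles X 1. finite {xs. h xs \<noteq> 0} \<and> (\<forall>xs. \<bar>h xs\<bar> \<le> N) \<and> (\<forall>xs\<in>W. h xs = f xs)"
proof -
  have fC: "f \<in> suf_chains X 1" using f(1) unfolding suf_cycles_def by simp
  obtain g where g: "g \<in> suf_chains X 2" "boundary X g = f"
    using cycle_is_boundary_if_trivial_homology[OF assms(3) f(1)] by (auto simp: numeral_2_eq_2)
  have "0 \<le> N" using f(2)[of undefined] by linarith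
  \<comment> \<open>Both directions are taken, because the prescribed arcs must form a symmetric
    set.\<close>
  define U where "U = {(u, v). (u, v) \<in> arcs X \<and> ([u, v] \<in> W \<or> [v, u] \<in> W)}"
  have "U \<subseteq> (\<lambda>xs. (xs ! 0, xs ! 1)) ` W \<union> (\<lambda>xs. (xs ! 1, xs ! 0)) ` W"
    unfolding U_def by force
  then have "finite U" using \<open>finite W\<close> finite_subset by blast
  have "sym U" unfolding U_def sym_def arcs_def by (auto simp: insert_commute)
  have "U \<subseteq> arcs X" unfolding U_def by auto
  note U = \<open>finite U\<close> \<open>sym U\<close> \<open>U \<subseteq> arcs X\<close>
  define E where "E = (thicken X ^^ card U) U"
  have E: "finite E" "sym E" "U \<subseteq> E" "E \<subseteq> arcs X"
    unfolding E_def using thicken_pow[OF assms(1,2) U] by blast+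
  have anti: "f [y, x] = - f [x, y]" for x y using fC unfolding suf_chains_1_iff by blast
  have cut: "(\<Sum>(u, v) | (u, v) \<in> U \<and> u \<notin> S \<and> v \<in> S. f [u, v])
     \<le> N * int (card {(u, v). (u, v) \<in> E - U \<and> u \<notin> S \<and> v \<in> S})" if "finite S" for S
    unfolding E_def by (rule cut_condition[OF assms(1,2) g(1) _ f(2) U that]) (simp add: g(2))
  obtain k where k: "\<forall>x y. k y x = - k x y" "\<forall>x y. \<bar>k x y\<bar> \<le> N"
    "\<forall>x y. (x, y) \<notin> E \<longrightarrow> k x y = 0" "\<forall>x y. (x, y) \<in> U \<longrightarrow> k x y = f [x, y]"
    "\<forall>v. (\<Sum>u\<in>Field E. k u v) = 0"
    using exists_circulation_extending[OF E(1,2) U(2) E(3) \<open>0 \<le> N\<close>, of "\<lambda>x y. f [x, y]", OF anti f(2) cut]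
    by blast
  define h where "h xs = (case xs of [x, y] \<Rightarrow> k x y | _ \<Rightarrow> 0)" for xs
  have h2: "h [x, y] = k x y" for x y by (simp add: h_def)
  have h0: "h xs = 0" if "length xs \<noteq> 2" for xs
    using that by (auto simp: h_def split: list.splits)
  have supp: "xs \<in> (\<lambda>(x, y). [x, y]) ` E" if "h xs \<noteq> 0" for xs
  proof -
    have "length xs = 2" using h0 that by blast
    then obtain x y where "xs = [x, y]" by (auto simp: numeral_2_eq_2 length_Suc_conv)
    then show ?thesis using that h2 k(3) by force
  qed
  have bd: "\<bar>h xs\<bar> \<le> N" for xs using k(2) \<open>0 \<le> N\<close> by (auto simp: h_def split: list.splits)
  have "h \<in> suf_chains X 1"
    unfolding suf_chains_1_iff
  proof (intro conjI allI impI exI)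
    show "h xs = 0" if "xs \<notin> ordered_simplices X 1" for xs
    proof (rule ccontr)
      assume "h xs \<noteq> 0"
      then obtain x y where "xs = [x, y]" "(x, y) \<in> E" using supp[of xs] by auto
      then show False using that E(4) by (auto simp: ordered_simplices_def arcs_def)
    qed
    show "h [y, x] = - h [x, y]" for x y unfolding h2 using k(1) by blast
    show "\<bar>h xs\<bar> \<le> N" for xs by (rule bd)
  qed
  \<comment> \<open>At a single vertex the boundary is the net inflow; for all other lengths
    \<open>h\<close> is zero on the lists involved.\<close>
  moreover have "boundary X h \<tau> = 0" for \<tau>
  proof (cases "length \<tau> = 1")
    case True
    then obtain v where v: "\<tau> = [v]" by (auto simp: length_Suc_conv)
    have "boundary X h \<tau> = (\<Sum>u | u \<notin> {v} \<and> {u, v} \<in> X. k u v)"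
      by (simp add: boundary_def v h2)
    also have "\<dots> = (\<Sum>u | (u, v) \<in> E. k u v)"
    proof (rule sum.mono_neutral_right)
      show "finite {u. u \<notin> {v} \<and> {u, v} \<in> X}"
        using finite_neighbours[OF assms(1,2), of v] by (rule rev_finite_subset) auto
    qed (use E(4) k(3) in \<open>auto simp: arcs_def\<close>)
    also have "\<dots> = (\<Sum>u\<in>Field E. k u v)"
      using E(1) k(3) by (intro sum.mono_neutral_left) (auto simp: finite_Field intro: FieldI1)
    finally show ?thesis using k(5) by simp
  next
    case False
    then show ?thesis by (simp add: boundary_def h0)
  qed
  ultimately have "h \<in> suf_cycles X 1" unfolding suf_cycles_def by auto
  moreover have "finite {xs. h xs \<noteq> 0}"
    by (rule finite_subset[of _ "(\<lambda>(x, y). [x, y]) ` E"]) (use supp E(1) in auto)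
  moreover have "h xs = f xs" if "xs \<in> W" for xs
  proof (cases "xs \<in> ordered_simplices X 1")
    case True
    then have "length xs = 2" by (simp add: ordered_simplices_def)
    then obtain x y where xy: "xs = [x, y]" by (auto simp: numeral_2_eq_2 length_Suc_conv)
    then have "(x, y) \<in> U" using True that by (simp add: U_def arcs_def ordered_simplices_def)
    then show ?thesis using k(4) h2 xy by simp
  next
    case False
    then show ?thesis
      using suf_chain_eq_0[OF fC] suf_chain_eq_0[OF \<open>h \<in> suf_chains X 1\<close>] by simp
  qed
  ultimately show ?thesis using bd by blast
qed

section \<open>The gliding hump\<close>

lemma suf_cycles_diff:
  assumes "c \<in> suf_cycles X n" "d \<in> suf_cycles X n"
  shows "(\<lambda>xs. c xs - d xs) \<in> suf_cycles X n"
  using assms suf_chains_diff[of c X n d] by (auto simp: suf_cycles_def boundary_diff fun_eq_iff)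

text \<open>Only finitely many patterns of norm at most \<open>N\<close> occur on \<open>W\<close>.\<close>

lemma uniformly_fillable_representatives:
  fixes N :: int
  assumes "simplicial_complex X" "ULF X" "trivial_group (suf_homology X 1)" and "finite W"
  shows "\<exists>c::nat. \<forall>f\<in>suf_cycles X 1. (\<forall>xs. \<bar>f xs\<bar> \<le> N) \<longrightarrow>
    (\<exists>r\<in>suf_cycles X 1. finite {xs. r xs \<noteq> 0} \<and> (\<forall>xs. \<bar>r xs\<bar> \<le> N) \<and> (\<forall>xs\<in>W. r xs = f xs) \<and>
      (\<exists>g\<in>suf_chains X 2. boundary X g = r \<and> (\<forall>xs. \<bar>g xs\<bar> \<le> int c)))"
proof -
  define Z where "Z = {f \<in> suf_cycles X 1. \<forall>xs. \<bar>f xs\<bar> \<le> N}"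
  define P where "P = (\<lambda>f xs. if xs \<in> W then f xs else 0) ` Z"
  have "P \<subseteq> {p. \<forall>xs. (xs \<in> W \<longrightarrow> p xs \<in> {-N..N}) \<and> (xs \<notin> W \<longrightarrow> p xs = 0)}"
  proof
    fix p assume "p \<in> P"
    then obtain f where f: "f \<in> Z" "p = (\<lambda>xs. if xs \<in> W then f xs else 0)" unfolding P_def by blast
    have "f xs \<in> {-N..N}" for xs
    proof -
      have "\<bar>f xs\<bar> \<le> N" using f(1) unfolding Z_def by blast
      then show ?thesis by auto
    qed
    then show "p \<in> {p. \<forall>xs. (xs \<in> W \<longrightarrow> p xs \<in> {-N..N}) \<and> (xs \<notin> W \<longrightarrow> p xs = 0)}"
      using f(2) by auto
  qed
  moreover have "finite {p. \<forall>xs. (xs \<in> W \<longrightarrow> p xs \<in> {-N..N}) \<and> (xs \<notin> W \<longrightarrow> p xs = 0)}"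
    using \<open>finite W\<close> by (intro finite_set_of_finite_funs) auto
  ultimately have "finite P" by (rule finite_subset)
  define rep where "rep p r c \<longleftrightarrow> r \<in> suf_cycles X 1 \<and> finite {xs. r xs \<noteq> 0} \<and> (\<forall>xs. \<bar>r xs\<bar> \<le> N) \<and>
      (\<forall>xs\<in>W. r xs = p xs) \<and>
      (\<exists>g\<in>suf_chains X 2. boundary X g = r \<and> (\<forall>xs. \<bar>g xs\<bar> \<le> int c))" for p r c
  \<comment> \<open>The representative and the bound of its filling depend on the pattern only, so
    the maximum over the finite set \<open>P\<close> serves every cycle.\<close>
  have "\<exists>r c. rep p r c" if "p \<in> P" for p
  proof -
    obtain f where f: "f \<in> suf_cycles X 1" "\<And>xs. \<bar>f xs\<bar> \<le> N" "\<And>xs. xs \<in> W \<Longrightarrow> p xs = f xs"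
      using \<open>p \<in> P\<close> unfolding P_def Z_def by auto
    obtain r where r: "r \<in> suf_cycles X 1" "finite {xs. r xs \<noteq> 0}" "\<forall>xs. \<bar>r xs\<bar> \<le> N"
      "\<forall>xs\<in>W. r xs = f xs"
      using finite_support_extension[OF assms(1-3) f(1,2) assms(4)] by blast
    obtain g where g: "g \<in> suf_chains X 2" "boundary X g = r"
      using cycle_is_boundary_if_trivial_homology[OF assms(3) r(1)] by (auto simp: numeral_2_eq_2)
    show ?thesis
      unfolding rep_def using r f(3) g abs_le_chain_norm[OF g(1)]
      by (intro exI[of _ r] exI[of _ "chain_norm g"]) auto
  qed
  then obtain r c where "\<And>p. p \<in> P \<Longrightarrow> rep p (r p) (c p)"
    by metis
  note rc = this[unfolded rep_def]
  show ?thesis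
  proof (intro exI[of _ "Max (c ` P)"] ballI impI)
    fix f assume f: "f \<in> suf_cycles X 1" "\<forall>xs. \<bar>f xs\<bar> \<le> N"
    define p where "p = (\<lambda>xs. if xs \<in> W then f xs else 0)"
    have "p \<in> P" using f unfolding P_def Z_def p_def by blast
    then have "int (c p) \<le> int (Max (c ` P))" using \<open>finite P\<close> by simp
    then have "\<exists>g\<in>suf_chains X 2. boundary X g = r p \<and> (\<forall>xs. \<bar>g xs\<bar> \<le> int (Max (c ` P)))"
      using rc[OF \<open>p \<in> P\<close>] by (meson order_trans)
    moreover have "\<forall>xs\<in>W. r p xs = f xs" using rc[OF \<open>p \<in> P\<close>] by (simp add: p_def)
    ultimately show "\<exists>r\<in>suf_cycles X 1. finite {xs. r xs \<noteq> 0} \<and> (\<forall>xs. \<bar>r xs\<bar> \<le> N) \<and>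
      (\<forall>xs\<in>W. r xs = f xs) \<and>
      (\<exists>g\<in>suf_chains X 2. boundary X g = r \<and> (\<forall>xs. \<bar>g xs\<bar> \<le> int (Max (c ` P))))"
      using rc[OF \<open>p \<in> P\<close>] by blast
  qed
qed

text \<open>Agreement is asked on \<open>V\<close> only, while the bound on the filling holds
  everywhere. Expansion calls for this local form.\<close>

definition fillable_on :: "'a set set \<Rightarrow> 'a list set \<Rightarrow> ('a list \<Rightarrow> int) \<Rightarrow> nat \<Rightarrow> bool" where
  "fillable_on X V f k \<longleftrightarrow>
     (\<exists>g\<in>suf_chains X 2. (\<forall>xs\<in>V. boundary X g xs = f xs) \<and> (\<forall>xs. \<bar>g xs\<bar> \<le> int k))"

text \<open>A badly fillable cycle is truncated, and the representative of its pattern on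
  \<open>W\<close> is subtracted. The difference vanishes on \<open>W\<close>, and a filling of it
  bounded by \<open>m\<close> would, with that of the representative, fill the original cycle too
  well.\<close>

lemma badly_fillable_away_from:
  fixes N :: nat
  assumes X: "simplicial_complex X" "ULF X" "trivial_group (suf_homology X 1)"
    and bad: "\<And>k. \<exists>V f. finite V \<and> f \<in> suf_cycles X 1 \<and> (\<forall>xs. \<bar>f xs\<bar> \<le> int N) \<and> \<not> fillable_on X V f k"
    and "finite W"
  shows "\<exists>h V. h \<in> suf_cycles X 1 \<and> finite {xs. h xs \<noteq> 0} \<and> (\<forall>xs. \<bar>h xs\<bar> \<le> 2 * int N) \<and>
    (\<forall>xs\<in>W. h xs = 0) \<and> finite V \<and> \<not> fillable_on X V h m"
proof -
  \<comment> \<open>\<open>c\<close> depends on \<open>W\<close> and \<open>N\<close> only, so a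
    cycle defeating \<open>m + c\<close> can be chosen afterwards.\<close>
  obtain c :: nat where c: "\<And>f. f \<in> suf_cycles X 1 \<Longrightarrow> \<forall>xs. \<bar>f xs\<bar> \<le> int N \<Longrightarrow>
    (\<exists>r\<in>suf_cycles X 1. finite {xs. r xs \<noteq> 0} \<and> (\<forall>xs. \<bar>r xs\<bar> \<le> int N) \<and> (\<forall>xs\<in>W. r xs = f xs) \<and>
      (\<exists>g\<in>suf_chains X 2. boundary X g = r \<and> (\<forall>xs. \<bar>g xs\<bar> \<le> int c)))"
    using uniformly_fillable_representatives[OF X \<open>finite W\<close>, of "int N"] by blast
  obtain V f' where V: "finite V" "f' \<in> suf_cycles X 1" "\<And>xs. \<bar>f' xs\<bar> \<le> int N"
    "\<not> fillable_on X V f' (m + c)" using bad[of "m + c"] by blast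
  obtain f where f: "f \<in> suf_cycles X 1" "finite {xs. f xs \<noteq> 0}" "\<forall>xs. \<bar>f xs\<bar> \<le> int N"
    "\<forall>xs\<in>V. f xs = f' xs"
    using finite_support_extension[OF X V(2,3,1)] by blast
  obtain r g where r: "r \<in> suf_cycles X 1" "finite {xs. r xs \<noteq> 0}" "\<forall>xs. \<bar>r xs\<bar> \<le> int N"
    "\<forall>xs\<in>W. r xs = f xs" and g: "g \<in> suf_chains X 2" "boundary X g = r" "\<forall>xs. \<bar>g xs\<bar> \<le> int c"
    using c[OF f(1,3)] by blast
  define h where "h = (\<lambda>xs. f xs - r xs)"
  have "h \<in> suf_cycles X 1" unfolding h_def by (rule suf_cycles_diff[OF f(1) r(1)])
  moreover have "finite {xs. h xs \<noteq> 0}"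
    by (rule finite_subset[OF _ finite_UnI[OF f(2) r(2)]]) (auto simp: h_def)
  moreover have "\<bar>h xs\<bar> \<le> 2 * int N" for xs
    using f(3)[rule_format, of xs] r(3)[rule_format, of xs] unfolding h_def by linarith
  moreover have "\<forall>xs\<in>W. h xs = 0" using r(4) by (simp add: h_def)
  moreover have "\<not> fillable_on X V h m"
  proof
    assume "fillable_on X V h m"
    then obtain k where k: "k \<in> suf_chains X 2" "\<forall>xs\<in>V. boundary X k xs = h xs"
      "\<forall>xs. \<bar>k xs\<bar> \<le> int m" unfolding fillable_on_def by blast
    have "\<bar>k xs + g xs\<bar> \<le> int (m + c)" for xs
      using k(3)[rule_format, of xs] g(3)[rule_format, of xs] by linarith
    moreover have "\<forall>xs\<in>V. boundary X (\<lambda>xs. k xs + g xs) xs = f' xs"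
      using k(2) g(2) f(4) by (simp add: boundary_add h_def)
    ultimately have "fillable_on X V f' (m + c)"
      unfolding fillable_on_def using suf_chains_add[OF k(1) g(1)] by blast
    then show False using V(4) by blast
  qed
  ultimately show ?thesis using V(1) by blast
qed

text \<open>Bad cycles with disjoint supports are summed to a bounded cycle \<open>H\<close>. If
  \<open>G\<close> fills \<open>H\<close> and has norm \<open>K\<close>, then \<open>G\<close> minus
  the fillings of the first \<open>K\<close> terms fills term \<open>K\<close> on its test set,
  within the bound that this term was chosen to defeat.\<close>

lemma uniformly_fillable:
  fixes N :: nat
  assumes X: "simplicial_complex X" "ULF X" "trivial_group (suf_homology X 1)"
  shows "\<exists>k. \<forall>V f. finite V \<longrightarrow> f \<in> suf_cycles X 1 \<longrightarrow> (\<forall>xs. \<bar>f xs\<bar> \<le> int N) \<longrightarrow> fillable_on X V f k"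
proof (rule ccontr)
  assume "\<not> ?thesis"
  then have bad: "\<exists>V f. finite V \<and> f \<in> suf_cycles X 1 \<and> (\<forall>xs. \<bar>f xs\<bar> \<le> int N) \<and> \<not> fillable_on X V f k" for k
    by blast
  define P where "P W m h V g \<longleftrightarrow> h \<in> suf_cycles X 1 \<and> finite {xs. h xs \<noteq> 0} \<and>
    (\<forall>xs. \<bar>h xs\<bar> \<le> 2 * int N) \<and> (\<forall>xs\<in>W. h xs = 0) \<and> finite V \<and> \<not> fillable_on X V h m \<and>
    g \<in> suf_chains X 2 \<and> boundary X g = h" for W m h V g
  have "\<exists>h V g. P W m h V g" if "finite W" for W m
  proof -
    obtain h V where h: "h \<in> suf_cycles X 1" "finite {xs. h xs \<noteq> 0}" "\<forall>xs. \<bar>h xs\<bar> \<le> 2 * int N"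
      "\<forall>xs\<in>W. h xs = 0" "finite V" "\<not> fillable_on X V h m"
      using badly_fillable_away_from[where m = m, OF X bad \<open>finite W\<close>] by blast
    obtain g where "g \<in> suf_chains X 2" "boundary X g = h"
      using cycle_is_boundary_if_trivial_homology[OF X(3) h(1)] by (auto simp: numeral_2_eq_2)
    then show ?thesis using h unfolding P_def by blast
  qed
  then obtain hh VV gg where step: "\<And>W m. finite W \<Longrightarrow> P W m (hh W m) (VV W m) (gg W m)"
    by metis
  \<comment> \<open>The state consists of the lists to be avoided, namely earlier supports and test
    sets, and the bound to be defeated. The bound grows by one plus the norm of the newest filling,
    so that it exceeds any later comparison of the form in \<open>m_ge\<close>.\<close>
  define st where "st = rec_nat ({}, 0::nat) (\<lambda>_ (W, m).
    (W \<union> VV W m \<union> {xs. hh W m xs \<noteq> 0}, Suc (m + chain_norm (gg W m))))"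
  define W where "W i = fst (st i)" for i
  define m where "m i = snd (st i)" for i
  define h where "h i = hh (W i) (m i)" for i
  define V where "V i = VV (W i) (m i)" for i
  define g where "g i = gg (W i) (m i)" for i
  have W_Suc: "W (Suc i) = W i \<union> V i \<union> {xs. h i xs \<noteq> 0}"
    and m_Suc: "m (Suc i) = Suc (m i + chain_norm (g i))" for i
    unfolding W_def m_def h_def V_def g_def st_def by (simp_all add: case_prod_unfold)
  have finW: "finite (W i)" for i
  proof (induction i)
    case 0
    then show ?case by (simp add: W_def st_def)
  next
    case (Suc i)
    then show ?case unfolding W_Suc V_def h_def using step[OF Suc, unfolded P_def] by blast
  qed
  have h: "h i \<in> suf_cycles X 1" "\<bar>h i xs\<bar> \<le> 2 * int N" "xs \<in> W i \<Longrightarrow> h i xs = 0"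
    "\<not> fillable_on X (V i) (h i) (m i)" "g i \<in> suf_chains X 2" "boundary X (g i) = h i" for i xs
    unfolding h_def V_def g_def using step[OF finW, unfolded P_def] by blast+
  have W_mono: "i \<le> j \<Longrightarrow> W i \<subseteq> W j" for i j
    by (rule lift_Suc_mono_le[of W]) (auto simp: W_Suc)
  have later: "h j xs = 0" if "i < j" "h i xs \<noteq> 0 \<or> xs \<in> V i" for i j xs
  proof -
    have "xs \<in> W (Suc i)" using that(2) unfolding W_Suc by blast
    then show ?thesis using W_mono[of "Suc i" j] that(1) h(3) by auto
  qed
  have m_ge: "int i + (\<Sum>j<i. int (chain_norm (g j))) \<le> int (m i)" for i
    by (induction i) (auto simp: m_Suc)
  \<comment> \<open>At most one term is nonzero at a given list, so the sum is finite pointwise, and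
    \<open>n xs\<close> is its cut-off.\<close>
  define n where "n xs = (LEAST n. \<forall>i\<ge>n. h i xs = 0)" for xs
  have n: "h i xs = 0" if "n xs \<le> i" for i xs
  proof -
    have "\<exists>n. \<forall>i\<ge>n. h i xs = 0"
    proof (cases "\<exists>i. h i xs \<noteq> 0")
      case True
      then obtain i where "h i xs \<noteq> 0" by blast
      then have "\<forall>j\<ge>Suc i. h j xs = 0" using later Suc_le_lessD by blast
      then show ?thesis by blast
    qed auto
    then have "\<forall>i\<ge>n xs. h i xs = 0" unfolding n_def by (rule LeastI_ex)
    then show ?thesis using that by blast
  qed
  define H where "H xs = (\<Sum>i<n xs. h i xs)" for xs
  have H: "H xs = (\<Sum>i<k. h i xs)" if "\<And>i. k \<le> i \<Longrightarrow> h i xs = 0" for k xs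
  proof -
    have "(\<Sum>i<k. h i xs) = (\<Sum>i<max k (n xs). h i xs)"
      using that by (intro sum.mono_neutral_left) auto
    moreover have "H xs = (\<Sum>i<max k (n xs). h i xs)"
      unfolding H_def using n by (intro sum.mono_neutral_left) auto
    ultimately show ?thesis by simp
  qed
  have hC: "h i \<in> suf_chains X 1" for i using h(1) unfolding suf_cycles_def by blast
  have bdH: "\<bar>H xs\<bar> \<le> 2 * int N" for xs
  proof (cases "\<exists>i. h i xs \<noteq> 0")
    case True
    then obtain i where i: "h i xs \<noteq> 0" by blast
    have "h j xs = 0" if "j \<noteq> i" for j
      using that later[of i j xs] later[of j i xs] i by (cases "i < j") auto
    moreover have "H xs = (\<Sum>j<Suc i. h j xs)" by (rule H) (use later i Suc_le_lessD in blast)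
    ultimately have "H xs = h i xs" by (simp add: sum.neutral)
    then show ?thesis using h(2) by simp
  qed (simp add: H_def)
  have "H \<in> suf_chains X 1"
    unfolding suf_chains_1_iff
  proof (intro conjI allI impI exI)
    show "H xs = 0" if "xs \<notin> ordered_simplices X 1" for xs
      unfolding H_def using suf_chain_eq_0[OF hC that] by simp
    show "H [y, x] = - H [x, y]" for x y
    proof -
      have anti: "h i [y, x] = - h i [x, y]" for i using hC unfolding suf_chains_1_iff by blast
      have "H [y, x] = (\<Sum>i<n [x, y]. h i [y, x])" by (rule H) (use anti n[of "[x, y]"] in auto)
      also have "\<dots> = - H [x, y]" unfolding H_def sum_negf[symmetric] by (rule sum.cong[OF refl anti])
      finally show ?thesis .
    qed
    show "\<bar>H xs\<bar> \<le> 2 * int N" for xs by (rule bdH)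
  qed
  moreover have "boundary X H \<tau> = 0" for \<tau>
  proof (cases "\<tau> = []")
    case False
    let ?A = "{v. v \<notin> set \<tau> \<and> insert v (set \<tau>) \<in> X}"
    have fin: "finite ?A" by (rule finite_cofaces[OF X(1,2) False])
    \<comment> \<open>This is a common cut-off for the finitely many cofaces, which lets the
      boundary pass through the sum; the 0 covers the case of no cofaces.\<close>
    define k where "k = Max (insert 0 ((\<lambda>v. n (v # \<tau>)) ` ?A))"
    have "H (v # \<tau>) = (\<Sum>i<k. h i (v # \<tau>))" if "v \<in> ?A" for v
    proof (rule H)
      fix i assume "k \<le> i"
      moreover have "n (v # \<tau>) \<le> k" unfolding k_def using fin that by (intro Max_ge) auto
      ultimately show "h i (v # \<tau>) = 0" by (intro n) simp
    qed
    then have "boundary X H \<tau> = boundary X (\<lambda>xs. \<Sum>i<k. h i xs) \<tau>"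
      unfolding boundary_def using False by (auto intro!: sum.cong)
    also have "\<dots> = (\<Sum>i<k. boundary X (h i) \<tau>)" by (rule boundary_sum)
    also have "\<dots> = 0" using h(1) unfolding suf_cycles_def by (intro sum.neutral) auto
    finally show ?thesis .
  qed (simp add: boundary_def)
  ultimately have "H \<in> suf_cycles X 1" unfolding suf_cycles_def by auto
  then obtain G where G: "G \<in> suf_chains X 2" "boundary X G = H"
    using cycle_is_boundary_if_trivial_homology[OF X(3)] by (auto simp: numeral_2_eq_2)
  \<comment> \<open>The norm of \<open>G\<close> also serves as the index of the term that gives the
    contradiction: \<open>m K\<close> bounds \<open>K\<close> plus the norms of all earlier
    fillings.\<close>
  define K where "K = chain_norm G"
  define G' where "G' = (\<lambda>xs. G xs - (\<Sum>j<K. g j xs))"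
  have "G' \<in> suf_chains X 2"
    unfolding G'_def using G(1) h(5) by (intro suf_chains_diff suf_chains_sum) auto
  moreover have "boundary X G' xs = h K xs" if "xs \<in> V K" for xs
  proof -
    have "boundary X G' xs = H xs - (\<Sum>j<K. h j xs)"
      unfolding G'_def boundary_diff boundary_sum G(2) h(6) ..
    \<comment> \<open>Terms after \<open>K\<close> vanish on \<open>V K\<close>, so only term
      \<open>K\<close> survives the subtraction.\<close>
    moreover have "H xs = (\<Sum>j<Suc K. h j xs)" by (rule H) (use later that Suc_le_lessD in blast)
    ultimately show ?thesis by simp
  qed
  moreover have "\<bar>G' xs\<bar> \<le> int (m K)" for xs
  proof -
    have "\<bar>\<Sum>j<K. g j xs\<bar> \<le> (\<Sum>j<K. int (chain_norm (g j)))"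
      by (rule order_trans[OF sum_abs]) (intro sum_mono abs_le_chain_norm[OF h(5)])
    moreover have "\<bar>G xs\<bar> \<le> int K" unfolding K_def by (rule abs_le_chain_norm[OF G(1)])
    ultimately show ?thesis using m_ge[of K] unfolding G'_def by linarith
  qed
  ultimately have "fillable_on X (V K) (h K) (m K)" unfolding fillable_on_def by blast
  then show False using h(4) by blast
qed

section \<open>Expansion from uniform fillability\<close>

theorem theorem6p6:
  fixes X :: "'a set set"
  assumes "simplicial_complex X"
    and "infinite (verts X)"
    and "vertex_transitive X"
    and "ULF X"
    and "trivial_group (suf_homology X 1)"
  shows "suf_expansion X 1"
proof -
  have "\<forall>N. \<exists>k. \<forall>V f. finite V \<longrightarrow> f \<in> suf_cycles X 1 \<longrightarrow> (\<forall>xs. \<bar>f xs\<bar> \<le> int N) \<longrightarrow> fillable_on X V f k"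
    using uniformly_fillable[OF assms(1,4,5)] by blast
  then obtain K :: "nat \<Rightarrow> nat" where K: "\<And>N V f. finite V \<Longrightarrow> f \<in> suf_cycles X 1 \<Longrightarrow>
      (\<forall>xs. \<bar>f xs\<bar> \<le> int N) \<Longrightarrow> fillable_on X V f (K N)"
    by metis
  have "\<exists>g\<in>suf_chains X (Suc 1). restrict_chain (boundary X g) U = f \<and> chain_norm g \<le> K (chain_norm f)"
    if "finite U" and f': "f' \<in> suf_cycles X 1" "restrict_chain f' U = f" "chain_norm f' = chain_norm f"
    for U f f'
  proof -
    have fC: "f' \<in> suf_chains X 1" using f'(1) unfolding suf_cycles_def by blast
    \<comment> \<open>These lists include all oriented edges within \<open>U\<close> and are finite
      in number, so the uniform bound applies to the extending cycle \<open>f'\<close>. On lists of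
      other lengths both sides are zero.\<close>
    define V where "V = {xs. set xs \<subseteq> U \<and> length xs = 2}"
    have "finite V" unfolding V_def using \<open>finite U\<close> by (rule finite_lists_length_eq)
    moreover have "\<forall>xs. \<bar>f' xs\<bar> \<le> int (chain_norm f)" using abs_le_chain_norm[OF fC] f'(3) by simp
    ultimately have "fillable_on X V f' (K (chain_norm f))" using K f'(1) by blast
    then obtain g where g: "g \<in> suf_chains X 2" "\<forall>xs\<in>V. boundary X g xs = f' xs"
      "\<forall>xs. \<bar>g xs\<bar> \<le> int (K (chain_norm f))" unfolding fillable_on_def by blast
    have g2: "g \<in> suf_chains X (Suc 1)" using g(1) by (simp add: numeral_2_eq_2)
    have "boundary X g xs = f' xs" if "set xs \<subseteq> U" for xs
    proof (cases "length xs = 2")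
      case True
      then show ?thesis using g(2) that by (simp add: V_def)
    next
      case False
      then have "xs \<notin> ordered_simplices X 1" by (auto simp: ordered_simplices_def)
      then show ?thesis using boundary_eq_0[OF assms(1) g2] suf_chain_eq_0[OF fC] by simp
    qed
    then have "restrict_chain (boundary X g) U = f"
      using f'(2) by (auto simp: restrict_chain_def)
    then show ?thesis using g2 chain_norm_le[of g "K (chain_norm f)"] g(3) by blast
  qed
  then show ?thesis unfolding suf_expansion_def by blast
qed

end
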